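(* Let $k\ge 1$ be an integer and let $P=\{p_1,\dots,p_n\}\subset\mathbb{R}^2$ be a point set with $x(p_1)<\cdots<x(p_n)$ in $k$-general position. Let $\lambda\in\Lambda([n],k+3)$, let $a<b<c$ be elements of $\bar\lambda$, and put $\mu_1=\lambda\setminus\{c\}$, $\mu_2=\lambda\setminus\{b\}$, $\mu_3=\lambda\setminus\{a\}$ (equivalently, $\mu_1,\mu_2,\mu_3\in\Lambda(\bar\lambda,k+2)$ with $\mu_1<\mu_2<\mu_3$ in lexicographic order). If $\chi_P^k(\mu_1)=-\chi_P^k(\mu_2)$, then $\chi_P^k(\mu_3)=\chi_P^k(\mu_2)$.
   Context: $[n]=\{1,\dots,n\}$. For a finite ordered set $S$ and a positive integer $r$, $\Lambda(S,r)=\{(\lambda_1,\dots,\lambda_r)\in S^r:\lambda_1<\cdots<\lambda_r\}$; for $\lambda\in\Lambda(S,r)$, $\bar\lambda=\{\lambda_1,\dots,\lambda_r\}$ and $\lambda\setminus\{\lambda_i\}$ is $\lambda$ with the entry $\lambda_i$ deleted. $x(p),y(p)$ are the coordinates of $p\in\mathbb{R}^2$. $P$ is in $k$-general position if no $k+2$ points of $P$ lie on the graph of a polynomial function of degree at most $k$. For $i_1<\cdots<i_{k+1}$, let $N_{i_1,\dots,i_{k+1}}$ be the unique real polynomial of degree at most $k$ whose graph $y=N_{i_1,\dots,i_{k+1}}(x)$ passes through $p_{i_1},\dots,p_{i_{k+1}}$. For $(i_1,\dots,i_{k+2})\in\Lambda([n],k+2)$, $\chi_P^k(i_1,\dots,i_{k+2})=\mathrm{sign}\bigl(y(p_{i_{k+2}})-N_{i_1,\dots,i_{k+1}}(x(p_{i_{k+2}}))\bigr)\in\{+1,-1\}$,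 i.e. $+1$ if $p_{i_{k+2}}$ lies above that graph and $-1$ if it lies below. *)

theory Defs
  imports Complex_Main "HOL-Computational_Algebra.Polynomial"
begin

text \<open>
  Points of the plane are pairs of reals, so \<^const>\<open>fst\<close> and \<^const>\<open>snd\<close> are the coordinate
  functions \<open>x\<close> and \<open>y\<close>. A point set \<open>P = {p\<^sub>1, \<dots>, p\<^sub>n}\<close> is given by its enumeration
  \<open>p :: nat \<Rightarrow> real \<times> real\<close>, of which only the values on \<open>{1..n}\<close> matter.
\<close>

text \<open>\<open>\<Lambda>(S, r)\<close>: an increasing tuple is a strictly sorted list, and its underlying set
  \<open>\<lambda>\<close>-bar is \<^const>\<open>set\<close>.\<close>

definition incr_tuples :: "'a::linorder set \<Rightarrow> nat \<Rightarrow> 'a list set" where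
  "incr_tuples S r = {l. length l = r \<and> set l \<subseteq> S \<and> sorted_wrt (<) l}"

definition general_position :: "nat \<Rightarrow> (real \<times> real) set \<Rightarrow> bool" where
  "general_position k P \<longleftrightarrow>
     (\<forall>Q \<subseteq> P. card Q = k + 2 \<longrightarrow>
        \<not> (\<exists>f :: real poly. degree f \<le> k \<and> (\<forall>z \<in> Q. snd z = poly f (fst z))))"

text \<open>The polynomial \<open>N\<close> through the points indexed by \<open>l\<close>; it exists and is unique if \<open>l\<close> has
  \<open>k + 1\<close> entries whose points have distinct abscissae, see \<open>interp_poly_unique\<close> below.\<close>

definition interp_poly :: "nat \<Rightarrow> (nat \<Rightarrow> real \<times> real) \<Rightarrow> nat list \<Rightarrow> real poly" where
  "interp_poly k p l =
     (THE f. degree f \<le> k \<and> (\<forall>i \<in> set l. poly f (fst (p i)) = snd (p i)))"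

text \<open>Lists are indexed from 0: for \<open>l = [i\<^sub>1, \<dots>, i\<^bsub>k+2\<^esub>]\<close>, \<open>take (k + 1) l\<close> is
  \<open>[i\<^sub>1, \<dots>, i\<^bsub>k+1\<^esub>]\<close> and \<open>l ! (k + 1)\<close> is \<open>i\<^bsub>k+2\<^esub>\<close>. In general position the value is never 0.\<close>

definition chi :: "nat \<Rightarrow> (nat \<Rightarrow> real \<times> real) \<Rightarrow> nat list \<Rightarrow> real" where
  "chi k p l =
     sgn (snd (p (l ! (k + 1))) - poly (interp_poly k p (take (k + 1) l)) (fst (p (l ! (k + 1)))))"

lemma interp_exists:
  fixes g :: "real \<Rightarrow> real"
  assumes "finite A"
  shows "\<exists>f :: real poly. degree f \<le> card A - 1 \<and> (\<forall>x \<in> A. poly f x = g x)"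
  using assms
proof (induction A rule: finite_induct)
  case empty
  show ?case by (intro exI[of _ 0]) simp
next
  case (insert a A)
  then obtain f :: "real poly"
    where f: "degree f \<le> card A - 1" "\<forall>x \<in> A. poly f x = g x" by blast
  define w where "w = (\<Prod>b\<in>A. [:-b, 1:])"
  have wa: "poly w a \<noteq> 0" and w0: "\<forall>x \<in> A. poly w x = 0"
    using insert.hyps by (auto simp: w_def poly_prod)
  have dw: "degree w = card A"
    unfolding w_def by (subst degree_prod_eq_sum_degree) auto
  define h where "h = f + smult ((g a - poly f a) / poly w a) w"
  have "degree h \<le> card A"
    unfolding h_def using f(1) dw
    by (intro degree_add_le) (auto intro: order_trans[OF degree_smult_le])
  moreover have "\<forall>x \<in> insert a A. poly h x = g x"
    using f(2) wa w0 by (auto simp: h_def)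
  ultimately show ?case using insert.hyps by (intro exI[of _ h]) auto
qed

lemma interp_poly_unique:
  assumes "length l = k + 1" "distinct l" "inj_on (\<lambda>i. fst (p i)) (set l)"
  shows "\<exists>!f :: real poly. degree f \<le> k \<and> (\<forall>i \<in> set l. poly f (fst (p i)) = snd (p i))"
proof (rule ex_ex1I)
  define A where "A = (\<lambda>i. fst (p i)) ` set l"
  define g where "g x = snd (p (the_inv_into (set l) (\<lambda>i. fst (p i)) x))" for x
  have cA: "card A = k + 1" and fA: "finite A"
    using assms by (simp_all add: A_def card_image distinct_card)
  obtain f :: "real poly" where f: "degree f \<le> card A - 1" "\<forall>x \<in> A. poly f x = g x"
    using interp_exists[OF fA] by blast
  have "poly f (fst (p i)) = snd (p i)" if "i \<in> set l" for i
    using f(2) that the_inv_into_f_f[OF assms(3) that] by (simp add: A_def g_def)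
  then show "\<exists>f :: real poly. degree f \<le> k \<and> (\<forall>i \<in> set l. poly f (fst (p i)) = snd (p i))"
    using f(1) cA by auto
next
  fix f h :: "real poly"
  assume f: "degree f \<le> k \<and> (\<forall>i \<in> set l. poly f (fst (p i)) = snd (p i))"
    and h: "degree h \<le> k \<and> (\<forall>i \<in> set l. poly h (fst (p i)) = snd (p i))"
  define A where "A = (\<lambda>i. fst (p i)) ` set l"
  have cA: "card A = k + 1"
    using assms by (simp add: A_def card_image distinct_card)
  show "f = h"
  proof (rule ccontr)
    assume "f \<noteq> h"
    then have nz: "f - h \<noteq> 0" by simp
    have "A \<subseteq> {x. poly (f - h) x = 0}" using f h by (auto simp: A_def)
    then have "card A \<le> card {x. poly (f - h) x = 0}"
      by (rule card_mono[OF poly_roots_finite[OF nz]])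
    also have "\<dots> \<le> degree (f - h)" by (rule card_poly_roots_bound[OF nz])
    also have "\<dots> \<le> k" using f h by (intro degree_diff_le) auto
    finally show False using cA by simp
  qed
qed

end

theory Submission
  imports Defs
begin

text \<open>
  The sign \<open>\<chi>(\<mu>)\<close> is the sign of the divided difference of the \<open>k + 2\<close> points indexed by \<open>\<mu>\<close>,
  i.e. of the coefficient of degree \<open>k + 1\<close> of the polynomial interpolating them.
  Let \<open>G\<close> interpolate all \<open>k + 3\<close> points of \<open>\<lambda>\<close>, with coefficient \<open>g\<close> in degree \<open>k + 2\<close>.
  Subtracting \<open>g \<Prod>\<^bsub>j \<noteq> i\<^esub> (X - x\<^sub>j)\<close> gives the interpolant for \<open>\<lambda>\<close> without \<open>i\<close>, so the divided
  difference of \<open>\<lambda>\<close> without \<open>i\<close> has the form \<open>E - g x\<^sub>i\<close> with \<open>E\<close> independent of \<open>i\<close>.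
  It is thus monotone in \<open>x\<^sub>i\<close>, and its sign changes at most once along \<open>c, b, a\<close>.
\<close>

lemma degree_prod_linear:
  fixes x :: "'i \<Rightarrow> 'a::idom"
  shows "degree (\<Prod>i\<in>I. [:- x i, 1:]) = card I"
  by (subst degree_prod_eq_sum_degree) auto

lemma coeff_card_prod_linear:
  fixes x :: "'i \<Rightarrow> 'a::idom"
  shows "coeff (\<Prod>i\<in>I. [:- x i, 1:]) (card I) = 1"
  using lead_coeff_prod[of "\<lambda>i. [:- x i, 1:]" I] by (simp add: degree_prod_linear)

text \<open>The shift by \<^const>\<open>pCons\<close> replaces the index \<open>card I - 1\<close>, which is wrong for empty \<open>I\<close>.\<close>

lemma coeff_pCons_prod_linear:
  fixes x :: "'i \<Rightarrow> 'a::idom"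
  assumes "finite I"
  shows "coeff (pCons 0 (\<Prod>i\<in>I. [:- x i, 1:])) (card I) = - (\<Sum>i\<in>I. x i)"
  using assms
proof (induction I rule: finite_induct)
  case (insert j I)
  then show ?case
    using coeff_card_prod_linear[of x I] by (simp add: coeff_pCons)
qed simp

lemma degree_diff_smult_prod_linear:
  fixes x :: "'i \<Rightarrow> 'a::idom"
  assumes "degree F \<le> Suc m" and "card I = Suc m"
  shows "degree (F - smult (coeff F (Suc m)) (\<Prod>i\<in>I. [:- x i, 1:])) \<le> m"
proof (rule degree_le, intro allI impI)
  fix i assume "m < i"
  show "coeff (F - smult (coeff F (Suc m)) (\<Prod>i\<in>I. [:- x i, 1:])) i = 0"
  proof (cases "i = Suc m")
    case True
    then show ?thesis using coeff_card_prod_linear[of x I] assms by simp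
  next
    case False
    with \<open>m < i\<close> have "degree F < i" "degree (\<Prod>i\<in>I. [:- x i, 1:]) < i"
      using assms by (simp_all add: degree_prod_linear)
    then show ?thesis by (simp add: coeff_eq_0)
  qed
qed

lemma poly_prod_linear_eq_0:
  fixes x :: "'i \<Rightarrow> 'a::idom"
  assumes "finite I" "i \<in> I"
  shows "poly (\<Prod>i\<in>I. [:- x i, 1:]) (x i) = 0"
  using assms by (auto simp: poly_prod)

text \<open>With \<open>w\<close> the monic polynomial vanishing at the first \<open>k + 1\<close>
  abscissae, \<open>F - smult (coeff F (k + 1)) w\<close> is the interpolant in \<open>chi\<close>.
  The last point thus lies above it by \<open>coeff F (k + 1)\<close> times the value of
  \<open>w\<close> there.\<close>

lemma chi_eq_sgn_coeff:
  fixes p :: "nat \<Rightarrow> real \<times> real"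
  assumes len: "length l = k + 2" and sorted: "sorted_wrt (<) l"
    and mono: "strict_mono_on (set l) (\<lambda>i. fst (p i))"
    and deg: "degree F \<le> k + 1"
    and interp: "\<And>i. i \<in> set l \<Longrightarrow> poly F (fst (p i)) = snd (p i)"
  shows "chi k p l = sgn (coeff F (k + 1))"
proof -
  define m where "m = take (k + 1) l"
  define z where "z = l ! (k + 1)"
  define w where "w = (\<Prod>i\<in>set m. [:- fst (p i), 1:])"
  define N where "N = F - smult (coeff F (k + 1)) w"
  have ms: "set m \<subseteq> set l" and zs: "z \<in> set l"
    using len by (auto simp: m_def z_def set_take_subset)
  have dist: "distinct m" and lm: "length m = k + 1"
    using sorted len by (auto simp: m_def strict_sorted_iff)
  have lt: "i < z" if "i \<in> set m" for i
    using that sorted len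
    by (auto simp: m_def z_def in_set_conv_nth sorted_wrt_iff_nth_less)
  have inj: "inj_on (\<lambda>i. fst (p i)) (set m)"
    using inj_on_subset[OF strict_mono_on_imp_inj_on[OF mono] ms] .
  have "degree N \<le> k"
    unfolding N_def w_def
    using degree_diff_smult_prod_linear[of F k "set m" "\<lambda>i. fst (p i)"] deg lm dist
    by (simp add: distinct_card)
  moreover have "\<forall>i\<in>set m. poly N (fst (p i)) = snd (p i)"
    using interp ms poly_prod_linear_eq_0[of "set m" _ "\<lambda>i. fst (p i)"]
    by (auto simp: N_def w_def)
  ultimately have "interp_poly k p m = N"
    unfolding interp_poly_def
    using the1_equality[OF interp_poly_unique[OF lm dist inj]] by blast
  then have "chi k p l = sgn (coeff F (k + 1) * poly w (fst (p z)))"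
    using interp[OF zs] unfolding chi_def m_def[symmetric] z_def[symmetric] by (simp add: N_def)
  \<comment> \<open>As \<open>z\<close> is the largest index, every factor
    \<open>fst (p z) - fst (p j)\<close> is positive.\<close>
  moreover have "poly w (fst (p z)) > 0"
    unfolding w_def poly_prod
    using strict_mono_onD[OF mono _ zs lt] ms by (auto intro!: prod_pos)
  ultimately show ?thesis by (simp add: sgn_mult)
qed

lemma chi_remove1_eq_sgn_affine:
  fixes p :: "nat \<Rightarrow> real \<times> real"
  assumes len: "length l = k + 3" and sorted: "sorted_wrt (<) l"
    and mono: "strict_mono_on (set l) (\<lambda>i. fst (p i))"
  obtains E g where "\<And>i. i \<in> set l \<Longrightarrow> chi k p (remove1 i l) = sgn (E - g * fst (p i))"
proof -
  have dist: "distinct l" using sorted by (simp add: strict_sorted_iff)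
  have inj: "inj_on (\<lambda>i. fst (p i)) (set l)" using strict_mono_on_imp_inj_on[OF mono] .
  \<comment> \<open>The degree bound is \<open>k + 2\<close> because all \<open>k + 3\<close> points
    are interpolated.\<close>
  obtain G :: "real poly" where degG: "degree G \<le> k + 2"
    and G: "\<And>i. i \<in> set l \<Longrightarrow> poly G (fst (p i)) = snd (p i)"
    using interp_poly_unique[of l "k + 2" p] len dist inj by auto
  define g where "g = coeff G (k + 2)"
  \<comment> \<open>By Vieta the product without \<open>i\<close> has second coefficient
    \<open>fst (p i)\<close> minus the sum over all of \<open>set l\<close>; \<open>E\<close>
    absorbs that sum, which does not depend on \<open>i\<close>.\<close>
  define E where "E = coeff G (k + 1) + g * (\<Sum>j\<in>set l. fst (p j))"
  show thesis
  proof (rule that[of E g])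
    fix i assume i: "i \<in> set l"
    define I where "I = set l - {i}"
    have I: "set (remove1 i l) = I" "card I = k + 2" "finite I" "I \<subseteq> set l"
      using i len dist by (auto simp: I_def distinct_card)
    define w where "w = (\<Prod>j\<in>I. [:- fst (p j), 1:])"
    define F where "F = G - smult g w"
    have "coeff w (k + 1) = - (\<Sum>j\<in>I. fst (p j))"
      using coeff_pCons_prod_linear[OF I(3), of "\<lambda>j. fst (p j)"] I(2)
      by (simp add: w_def coeff_pCons)
    also have "\<dots> = fst (p i) - (\<Sum>j\<in>set l. fst (p j))"
      using i by (simp add: I_def sum_diff1)
    finally have w_coeff: "coeff w (k + 1) = fst (p i) - (\<Sum>j\<in>set l. fst (p j))" .
    have F_coeff: "coeff F (k + 1) = E - g * fst (p i)"
      unfolding F_def E_def coeff_diff coeff_smult w_coeff by (simp add: algebra_simps)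
    have "degree F \<le> k + 1"
      unfolding F_def g_def w_def
      using degree_diff_smult_prod_linear[of G "k + 1" I "\<lambda>j. fst (p j)"] degG I(2) by simp
    moreover have "poly F (fst (p j)) = snd (p j)" if "j \<in> set (remove1 i l)" for j
      using that I G poly_prod_linear_eq_0[of I j "\<lambda>j. fst (p j)"]
      by (auto simp: F_def w_def)
    moreover have "sorted_wrt (<) (remove1 i l)"
      using sorted dist by (simp add: strict_sorted_iff sorted_remove1)
    ultimately have "chi k p (remove1 i l) = sgn (coeff F (k + 1))"
      using i len I mono
      by (intro chi_eq_sgn_coeff)
        (auto simp: length_remove1 intro: monotone_on_subset)
    then show "chi k p (remove1 i l) = sgn (E - g * fst (p i))"
      by (simp only: F_coeff)
  qed
qed

text \<open>For nonzero \<open>g\<close> strict monotonicity keeps the opposite signs at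
  \<open>y\<close> and \<open>z\<close> from both being 0, and from \<open>y\<close> to
  \<open>x\<close> the value moves further from 0. For \<open>g = 0\<close> all signs agree.\<close>

lemma sgn_affine_eq:
  fixes E g :: "'a::linordered_idom"
  assumes "x < y" "y < z" and opp: "sgn (E - g * z) = - sgn (E - g * y)"
  shows "sgn (E - g * x) = sgn (E - g * y)"
proof (cases g "0::'a" rule: linorder_cases)
  case less
  then have "g * x > g * y" "g * y > g * z" using assms by simp_all
  with opp show ?thesis by (auto simp: sgn_if split: if_splits)
next
  case greater
  then have "g * x < g * y" "g * y < g * z" using assms by simp_all
  with opp show ?thesis by (auto simp: sgn_if split: if_splits)
qed simp

theorem proposition3p3:
  fixes k n :: nat and p :: "nat \<Rightarrow> real \<times> real" and l :: "nat list" and a b c :: nat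
  assumes "k \<ge> 1"
    and "strict_mono_on {1..n} (\<lambda>i. fst (p i))"
    and "general_position k (p ` {1..n})"
    and "l \<in> incr_tuples {1..n} (k + 3)"
    and "a \<in> set l" and "b \<in> set l" and "c \<in> set l"
    and "a < b" and "b < c"
    and "chi k p (remove1 c l) = - chi k p (remove1 b l)"
  shows "chi k p (remove1 a l) = chi k p (remove1 b l)"
proof -
  have l: "length l = k + 3" "sorted_wrt (<) l" "set l \<subseteq> {1..n}"
    using assms(4) by (auto simp: incr_tuples_def)
  have mono: "strict_mono_on (set l) (\<lambda>i. fst (p i))"
    using monotone_on_subset[OF assms(2) l(3)] .
  obtain E g where chi: "\<And>i. i \<in> set l \<Longrightarrow> chi k p (remove1 i l) = sgn (E - g * fst (p i))"
    using chi_remove1_eq_sgn_affine[OF l(1,2) mono] by blast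
  have "fst (p a) < fst (p b)" "fst (p b) < fst (p c)"
    using assms(5-9) strict_mono_onD[OF mono] by auto
  then show ?thesis
    using sgn_affine_eq[of "fst (p a)" "fst (p b)" "fst (p c)" E g] assms(5-7,10)
    by (simp add: chi)
qed

end
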